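(* Let $(X,\mathcal{A},\lambda)$ be a $\sigma$-finite measure space, $T:X\to X$ a null-preserving map, and $A\in\mathcal{A}$. Then $A$ is a nonsingular set for the system $\mathfrak{S}=(X,\mathcal{A},\lambda,T)$ if and only if $\hat{T}A\overset{.}{=}A$. In particular, $\mathfrak{S}$ is nonsingular if and only if $\hat{T}X\overset{.}{=}X$.
   Context: For $A,B\in\mathcal{A}$ write $A\overset{.}{\subseteq}B$ if $\lambda(A\setminus B)=0$ and $A\overset{.}{=}B$ if $\lambda(A\triangle B)=0$. A measurable map $T:X\to X$ is null-preserving if $\lambda(A)=0$ implies $\lambda(T^{-1}A)=0$ for $A\in\mathcal{A}$. An essential image of $A\in\mathcal{A}$ under $T$ is a set $A'\in\mathcal{A}$ such that $T^{-1}A'\overset{.}{\supseteq}A$ and such that every $B'\in\mathcal{A}$ with $T^{-1}B'\overset{.}{\supseteq}A$ satisfies $B'\overset{.}{\supseteq}A'$. In the present ($\sigma$-finite, null-preserving) setting every $A\in\mathcal{A}$ has essential images and they form exactly one equivalence class under $\overset{.}{=}$; $\hat{T}A$ denotes an arbitrary fixed essential image of $A$. The system is nonsingular if $\lambda\circ T^{-1}$ and $\lambda$ are mutually absolutely continuous. A set $A\in\mathcal{A}$ is forward invariant if $A\overset{.}{\subseteq}T^{-1}A$; then $T$ maps a.e. point of $A$ into $A$ and one has the restricted null-preserving system $\mathfrak{S}|_A=(A,A\cap\mathcal{A},\lambda|_{A\cap\mathcal{A}},T|_A)$ (maps need only be defined outside a null-set). $A\in\mathcal{A}$ is a nonsingular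 set for $\mathfrak{S}$ if it is forward invariant and $\mathfrak{S}|_A$ is nonsingular, i.e. for measurable $B\subseteq A$, $\lambda(B)=0$ iff $\lambda(A\cap T^{-1}B)=0$. *)

theory Defs
  imports "HOL-Analysis.Analysis"
begin

definition ess_subset :: "'a measure \<Rightarrow> 'a set \<Rightarrow> 'a set \<Rightarrow> bool" where
  "ess_subset M A B \<longleftrightarrow> emeasure M (A - B) = 0"

definition ess_eq :: "'a measure \<Rightarrow> 'a set \<Rightarrow> 'a set \<Rightarrow> bool" where
  "ess_eq M A B \<longleftrightarrow> emeasure M (sym_diff A B) = 0"

definition null_preserving :: "'a measure \<Rightarrow> ('a \<Rightarrow> 'a) \<Rightarrow> bool" where
  "null_preserving M T \<longleftrightarrow> T \<in> measurable M M \<and>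
     (\<forall>A\<in>sets M. emeasure M A = 0 \<longrightarrow> emeasure M (T -` A \<inter> space M) = 0)"

definition essential_image :: "'a measure \<Rightarrow> ('a \<Rightarrow> 'a) \<Rightarrow> 'a set \<Rightarrow> 'a set \<Rightarrow> bool" where
  "essential_image M T A A' \<longleftrightarrow> A' \<in> sets M \<and> ess_subset M A (T -` A' \<inter> space M) \<and>
     (\<forall>B'\<in>sets M. ess_subset M A (T -` B' \<inter> space M) \<longrightarrow> ess_subset M A' B')"

definition nonsingular_system :: "'a measure \<Rightarrow> ('a \<Rightarrow> 'a) \<Rightarrow> bool" where
  "nonsingular_system M T \<longleftrightarrow>
     absolutely_continuous (distr M M T) M \<and> absolutely_continuous M (distr M M T)"

definition forward_invariant :: "'a measure \<Rightarrow> ('a \<Rightarrow> 'a) \<Rightarrow> 'a set \<Rightarrow> bool" where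
  "forward_invariant M T A \<longleftrightarrow> A \<in> sets M \<and> ess_subset M A (T -` A \<inter> space M)"

text \<open>
  \<open>T\<close> maps \<open>A\<close> into itself only up to a null set, so nonsingularity of the restricted system is
  written out with the preimages \<open>A \<inter> T -` B\<close>.  The lemma \<open>nonsingular_set_iff_restricted\<close> below
  shows that this is \<open>nonsingular_system\<close> for every version of the restricted map.
\<close>

definition nonsingular_set :: "'a measure \<Rightarrow> ('a \<Rightarrow> 'a) \<Rightarrow> 'a set \<Rightarrow> bool" where
  "nonsingular_set M T A \<longleftrightarrow> forward_invariant M T A \<and>
     (\<forall>B\<in>sets M. B \<subseteq> A \<longrightarrow> (emeasure M B = 0 \<longleftrightarrow> emeasure M (A \<inter> T -` B) = 0))"

lemma nonsingular_system_iff: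
  assumes "T \<in> measurable M M"
  shows "nonsingular_system M T \<longleftrightarrow>
    (\<forall>B\<in>sets M. emeasure M B = 0 \<longleftrightarrow> emeasure M (T -` B \<inter> space M) = 0)"
proof -
  have "B \<in> null_sets (distr M M T) \<longleftrightarrow> B \<in> sets M \<and> emeasure M (T -` B \<inter> space M) = 0" for B
    using measurable_sets[OF assms, of B] emeasure_distr[OF assms, of B]
    by (auto simp: null_sets_def)
  moreover have "B \<in> null_sets M \<longleftrightarrow> B \<in> sets M \<and> emeasure M B = 0" for B
    by (auto simp: null_sets_def)
  ultimately show ?thesis
    unfolding nonsingular_system_def absolutely_continuous_def subset_iff by meson
qed

lemma nonsingular_set_iff_restricted:
  assumes T: "T \<in> measurable M M" and A: "forward_invariant M T A"
    and S: "S \<in> measurable (restrict_space M A) (restrict_space M A)"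
    and eq: "AE x in restrict_space M A. S x = T x"
  shows "nonsingular_set M T A \<longleftrightarrow> nonsingular_system (restrict_space M A) S"
proof -
  have AM: "A \<in> sets M" and AI: "A \<inter> space M \<in> sets M" and Asub: "A \<subseteq> space M"
    using A sets.sets_into_space by (auto simp: forward_invariant_def)
  have sp: "space (restrict_space M A) = A"
    using Asub by (auto simp: space_restrict_space)
  have sR: "B \<in> sets (restrict_space M A) \<longleftrightarrow> B \<in> sets M \<and> B \<subseteq> A" for B
    using sets_restrict_space_iff[OF AI] by auto
  have em: "emeasure (restrict_space M A) B = emeasure M B" if "B \<subseteq> A" for B
    using emeasure_restrict_space[OF AI that] .
  have pre: "emeasure M (S -` B \<inter> A) = emeasure M (A \<inter> T -` B)" if B: "B \<in> sets M" "B \<subseteq> A" for B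
  proof -
    have "S -` B \<inter> A \<in> sets (restrict_space M A)"
      using measurable_sets[OF S, of B] B sp sR by auto
    moreover have "A \<inter> T -` B = A \<inter> (T -` B \<inter> space M)" using Asub by auto
    then have "A \<inter> T -` B \<in> sets (restrict_space M A)"
      using measurable_sets[OF T B(1)] AM sR by auto
    ultimately have "emeasure (restrict_space M A) (S -` B \<inter> A) = emeasure (restrict_space M A) (A \<inter> T -` B)"
      using eq by (intro emeasure_eq_AE) auto
    then show ?thesis using em by auto
  qed
  show ?thesis
  proof -
    have "emeasure (restrict_space M A) B = 0 \<longleftrightarrow> emeasure M B = 0"
      "emeasure (restrict_space M A) (S -` B \<inter> A) = 0 \<longleftrightarrow> emeasure M (A \<inter> T -` B) = 0"
      if "B \<in> sets M" "B \<subseteq> A" for B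
      using em[of B] em[of "S -` B \<inter> A"] pre[OF that] that by simp_all
    then show ?thesis
      unfolding nonsingular_set_def nonsingular_system_iff[OF S] sp using A sR by meson
  qed
qed

lemma essential_image_exists:
  assumes "sigma_finite_measure M" and np: "null_preserving M T" and A: "A \<in> sets M"
  shows "\<exists>A'. essential_image M T A A'"
proof -
  interpret sigma_finite_measure M by fact
  have T: "T \<in> measurable M M" using np by (simp add: null_preserving_def)
  have Asub: "A \<subseteq> space M" using A sets.sets_into_space by auto
  define N where "N = distr (density M (indicator A)) M T"
  have N: "emeasure N B = emeasure M (A \<inter> (T -` B \<inter> space M))" if "B \<in> sets M" for B
  proof -
    have TB: "T -` B \<inter> space M \<in> sets M" using measurable_sets[OF T that] .
    have "emeasure N B = emeasure (density M (indicator A)) (T -` B \<inter> space M)"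
      using T that by (simp add: N_def emeasure_distr)
    also have "\<dots> = emeasure M (A \<inter> (T -` B \<inter> space M))"
      using TB A by (simp add: emeasure_density flip: indicator_inter_arith)
    finally show ?thesis .
  qed
  have sN: "sets N = sets M" by (simp add: N_def)
  have "absolutely_continuous M N"
    unfolding absolutely_continuous_def
  proof
    fix B assume B: "B \<in> null_sets M"
    have TB: "T -` B \<inter> space M \<in> null_sets M"
      using np B measurable_sets[OF T, of B] by (auto simp: null_preserving_def null_sets_def)
    have "A \<inter> (T -` B \<inter> space M) \<in> null_sets M" using null_set_Int1[OF TB A] .
    then show "B \<in> null_sets N" using B N[of B] sN by (auto simp: null_sets_def)
  qed
  then obtain f where f: "f \<in> borel_measurable M" "density M f = N"
    using Radon_Nikodym[OF _ sN] by blast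
  define A' where "A' = {x\<in>space M. f x \<noteq> 0}"
  have A': "A' \<in> sets M" unfolding A'_def using f(1) by measurable
  have key: "emeasure M (A \<inter> (T -` B \<inter> space M)) = 0 \<longleftrightarrow> emeasure M (B \<inter> A') = 0"
    if B: "B \<in> sets M" for B
  proof -
    have "emeasure N B = 0 \<longleftrightarrow> B \<in> null_sets (density M f)"
      using B f(2) sN by (auto simp: null_sets_def)
    also have "\<dots> \<longleftrightarrow> (AE x in M. x \<in> B \<longrightarrow> f x = 0)"
      using null_sets_density_iff[OF f(1)] B by auto
    also have "\<dots> \<longleftrightarrow> (AE x in M. x \<notin> B \<inter> A')"
      by (rule AE_cong) (auto simp: A'_def)
    also have "\<dots> \<longleftrightarrow> B \<inter> A' \<in> null_sets M"
      using AE_iff_null_sets[of "B \<inter> A'" M] A' B by auto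
    also have "\<dots> \<longleftrightarrow> emeasure M (B \<inter> A') = 0"
      using A' B by (auto simp: null_sets_def)
    finally show ?thesis using N[OF B] by simp
  qed
  have cov: "ess_subset M A (T -` B \<inter> space M) \<longleftrightarrow> ess_subset M A' B" if B: "B \<in> sets M" for B
  proof -
    have "A - T -` B \<inter> space M = A \<inter> (T -` (space M - B) \<inter> space M)"
      using Asub measurable_space[OF T] by auto
    moreover have "A' - B = (space M - B) \<inter> A'" by (auto simp: A'_def)
    ultimately show ?thesis using key[of "space M - B"] B by (auto simp: ess_subset_def)
  qed
  have "essential_image M T A A'"
    unfolding essential_image_def using A' cov by (auto simp: ess_subset_def)
  then show ?thesis ..
qed

lemma essential_image_unique:
  assumes A': "essential_image M T A A'" and B': "essential_image M T A B'"
  shows "ess_eq M A' B'"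
proof -
  have "A' - B' \<in> null_sets M" "B' - A' \<in> null_sets M"
    using assms by (auto simp: essential_image_def ess_subset_def null_sets_def)
  then have "sym_diff A' B' \<in> null_sets M" by (rule null_sets.Un)
  then show ?thesis by (auto simp: ess_eq_def)
qed

end

theory Submission
  imports Defs
begin

text \<open>
  By null-preservation, an essential image \<open>A'\<close> of \<open>A\<close> satisfies the Galois-type equivalence
  \<open>A \<subseteq> T\<^sup>-\<^sup>1 C \<longleftrightarrow> A' \<subseteq> C\<close> modulo null sets; passing to complements, \<open>A \<inter> T\<^sup>-\<^sup>1 B\<close> is null iff
  \<open>A' \<inter> B\<close> is null. Forward invariance thus says \<open>A' \<subseteq> A\<close>, and nonsingularity on \<open>A\<close> says that
  subsets of \<open>A\<close> are null iff their traces on \<open>A'\<close> are, i.e. \<open>A \<subseteq> A'\<close>.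
\<close>

text \<open>Since \<open>emeasure\<close> is 0 by default outside \<open>sets M\<close>,
  measurability is what turns vanishing measure into membership in \<open>null_sets M\<close>, which
  is closed under unions and measurable subsets.\<close>

lemma ess_subset_iff_null_sets:
  assumes "A \<in> sets M" "B \<in> sets M"
  shows "ess_subset M A B \<longleftrightarrow> A - B \<in> null_sets M"
  using assms by (auto simp: ess_subset_def null_sets_def)

lemma ess_eq_iff_ess_subset:
  assumes "A \<in> sets M" "B \<in> sets M"
  shows "ess_eq M A B \<longleftrightarrow> ess_subset M A B \<and> ess_subset M B A"
proof -
  have "ess_eq M A B \<longleftrightarrow> sym_diff A B \<in> null_sets M"
    using assms by (auto simp: ess_eq_def null_sets_def)
  also have "\<dots> \<longleftrightarrow> A - B \<in> null_sets M \<and> B - A \<in> null_sets M"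
    using assms null_sets_subset[of "sym_diff A B" M "A - B"]
      null_sets_subset[of "sym_diff A B" M "B - A"] by auto
  finally show ?thesis using assms by (simp add: ess_subset_iff_null_sets)
qed

text \<open>Left to right is the minimality of \<open>A'\<close>. Conversely, a point of
  \<open>A\<close> that misses the preimage of \<open>C\<close> either misses that of
  \<open>A'\<close> or is mapped into \<open>A' - C\<close>; the latter set of points is null by
  null-preservation.\<close>

lemma ess_subset_vimage_iff:
  assumes np: "null_preserving M T" and A: "A \<in> sets M"
    and im: "essential_image M T A A'" and C: "C \<in> sets M"
  shows "ess_subset M A (T -` C \<inter> space M) \<longleftrightarrow> ess_subset M A' C"
proof
  assume "ess_subset M A (T -` C \<inter> space M)"
  then show "ess_subset M A' C" using im C by (simp add: essential_image_def)
next
  assume "ess_subset M A' C"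
  moreover have A': "A' \<in> sets M" using im by (simp add: essential_image_def)
  moreover have T: "T \<in> measurable M M" using np by (simp add: null_preserving_def)
  ultimately have "T -` (A' - C) \<inter> space M \<in> null_sets M"
    using np C measurable_sets[OF T, of "A' - C"]
    by (auto simp: null_preserving_def ess_subset_def)
  moreover have "A - T -` A' \<inter> space M \<in> null_sets M"
    using im A A' measurable_sets[OF T A']
    by (auto simp: essential_image_def ess_subset_def)
  ultimately have "(A - T -` A' \<inter> space M) \<union> (T -` (A' - C) \<inter> space M) \<in> null_sets M"
    by auto
  then have "A - T -` C \<inter> space M \<in> null_sets M"
    by (rule null_sets_subset) (use A measurable_sets[OF T C] in auto)
  then show "ess_subset M A (T -` C \<inter> space M)" by (auto simp: ess_subset_def)
qed

lemma null_Int_vimage_iff: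
  assumes np: "null_preserving M T" and A: "A \<in> sets M"
    and im: "essential_image M T A A'" and B: "B \<in> sets M"
  shows "emeasure M (A \<inter> T -` B) = 0 \<longleftrightarrow> emeasure M (A' \<inter> B) = 0"
proof -
  have T: "T \<in> measurable M M" using np by (simp add: null_preserving_def)
  have Asub: "A \<subseteq> space M" and Bsub: "B \<subseteq> space M"
    using A B sets.sets_into_space by auto
  have A'sub: "A' \<subseteq> space M"
    using im sets.sets_into_space by (auto simp: essential_image_def)
  \<comment> \<open>\<open>T\<close> keeps points of \<open>A\<close> in \<open>space M\<close>, so
    missing the complement of \<open>B\<close> means landing in \<open>B\<close>.\<close>
  have "A - T -` (space M - B) \<inter> space M = A \<inter> T -` B"
    using Asub Bsub measurable_space[OF T] by auto
  moreover have "A' - (space M - B) = A' \<inter> B" using A'sub by auto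
  ultimately show ?thesis
    using ess_subset_vimage_iff[OF np A im, of "space M - B"] B by (simp add: ess_subset_def)
qed

lemma nonsingular_set_iff_ess_eq:
  assumes np: "null_preserving M T" and A: "A \<in> sets M"
    and im: "essential_image M T A A'"
  shows "nonsingular_set M T A \<longleftrightarrow> ess_eq M A' A"
proof -
  have A': "A' \<in> sets M" using im by (simp add: essential_image_def)
  have fwd: "forward_invariant M T A \<longleftrightarrow> ess_subset M A' A"
    using ess_subset_vimage_iff[OF np A im A] A by (simp add: forward_invariant_def)
  \<comment> \<open>The quantified side is the nullity condition of \<open>nonsingular_set\<close>
    with the part of \<open>A\<close> mapped into \<open>B\<close> traded for the trace of
    \<open>B\<close> on \<open>A'\<close>.\<close>
  have "(\<forall>B\<in>sets M. B \<subseteq> A \<longrightarrow> (emeasure M B = 0 \<longleftrightarrow> emeasure M (A' \<inter> B) = 0))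
      \<longleftrightarrow> ess_subset M A A'" (is "?L \<longleftrightarrow> _")
  proof
    \<comment> \<open>The test set \<open>A - A'\<close> has empty trace on \<open>A'\<close>, so
      \<open>?L\<close> forces it to be null.\<close>
    assume ?L
    then show "ess_subset M A A'"
      using A A' by (auto simp: ess_subset_def dest!: bspec[of _ _ "A - A'"])
  next
    assume "ess_subset M A A'"
    then have N: "A - A' \<in> null_sets M" using A A' by (simp add: ess_subset_iff_null_sets)
    show ?L
    proof (intro ballI impI iffI)
      fix B assume B: "B \<in> sets M" "B \<subseteq> A" and "emeasure M B = 0"
      then have "B \<in> null_sets M" by auto
      then show "emeasure M (A' \<inter> B) = 0" using null_set_Int1[of B M A'] A' by (auto simp: Int_commute)
    next
      fix B assume B: "B \<in> sets M" "B \<subseteq> A" and "emeasure M (A' \<inter> B) = 0"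
      then have "A' \<inter> B \<in> null_sets M" using A' by auto
      \<comment> \<open>These two null sets cover \<open>B\<close>: one its part outside
        \<open>A'\<close>, the other its part inside.\<close>
      with N have "(A - A') \<union> (A' \<inter> B) \<in> null_sets M" by auto
      then have "B \<in> null_sets M" by (rule null_sets_subset) (use B in auto)
      then show "emeasure M B = 0" by auto
    qed
  qed
  then show ?thesis
    using fwd null_Int_vimage_iff[OF np A im]
    by (auto simp: nonsingular_set_def ess_eq_iff_ess_subset[OF A' A])
qed

text \<open>The whole space is forward invariant because \<open>T\<close> maps it into itself, so
  the claim on systems becomes the case \<open>A = space M\<close> of the claim on sets.\<close>

lemma nonsingular_set_space_iff:
  assumes T: "T \<in> measurable M M"
  shows "nonsingular_set M T (space M) \<longleftrightarrow> nonsingular_system M T"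
proof -
  have "space M - T -` space M \<inter> space M = {}"
    using measurable_space[OF T] by auto
  then have "forward_invariant M T (space M)"
    by (simp only: forward_invariant_def ess_subset_def sets.top emeasure_empty)
  then show ?thesis
    using sets.sets_into_space
    by (auto simp: nonsingular_set_def nonsingular_system_iff[OF T] Int_commute)
qed

theorem theorem4p3:
  fixes M :: "'a measure" and T :: "'a \<Rightarrow> 'a" and A :: "'a set"
  assumes "sigma_finite_measure M"
    and "null_preserving M T"
    and "A \<in> sets M"
  shows "(\<forall>A'. essential_image M T A A' \<longrightarrow> (nonsingular_set M T A \<longleftrightarrow> ess_eq M A' A)) \<and>
         (\<forall>X'. essential_image M T (space M) X' \<longrightarrow>
            (nonsingular_system M T \<longleftrightarrow> ess_eq M X' (space M)))"
proof -
  have "T \<in> measurable M M" using assms(2) by (simp add: null_preserving_def)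
  then show ?thesis
    using nonsingular_set_iff_ess_eq[OF assms(2,3)]
      nonsingular_set_iff_ess_eq[OF assms(2) sets.top] nonsingular_set_space_iff
    by blast
qed

end
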